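(* Let $m,n,r$ be positive integers with $rm\le n$, let $q=2^m$, let $G(x)\in\mathbb{F}_q[x]$ have degree $r$, and let $\mathcal{L}=\{f_1(x),\dots,f_n(x)\}$ be a set of $n$ irreducible polynomials in $\mathbb{F}_q[x]$ with $\gcd(f_i(x),f_j(x))=1$ for all $i\ne j$ and $\gcd(f_i(x),G(x))=1$ for all $i$. Let $\Gamma(\mathcal{L},G)$ be the associated binary generalized Goppa code and let $\mathbf{H}^{\mathrm{bin}}\in\mathbb{F}_2^{rm\times n}$ be its binary parity-check matrix defined in the context. Then the dimension of $\Gamma(\mathcal{L},G)$ over $\mathbb{F}_2$ is $$k(\Gamma)=n-\operatorname{rank}(\mathbf{H}^{\mathrm{bin}})\ \ge\ n-rm,$$ and its minimum Hamming distance satisfies $$d(\Gamma)\ \ge\ \frac{r+1}{l},\qquad l=\max_{f(x)\in\mathcal{L}}\deg f(x).$$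
   Context: The binary generalized Goppa code is $$\Gamma(\mathcal{L},G)=\Bigl\{\mathbf{c}\in\mathbb{F}_2^n : \sum_{i=1}^n c_i\frac{f_i'(x)}{f_i(x)}= 0 \bmod G(x)\Bigr\},$$ where $f_i'$ is the formal derivative and $1/f_i(x)$ is the inverse of $f_i(x)$ in $\mathbb{F}_q[x]/(G(x))$. The minimum Hamming distance $d(\Gamma)$ is the minimum number of nonzero entries over nonzero codewords (the bound is vacuous if $\Gamma=\{\mathbf{0}\}$). Definition of $\mathbf{H}^{\mathrm{bin}}$: let $l_i=\deg f_i$ and let $\gamma_i\in\mathbb{F}_{q^{l_i}}$ be a root of $f_i$ (the roots of $f_i$ are then $\gamma_i^{q^\iota}$, $0\le\iota\le l_i-1$). Let $\mathbf{H}\in\mathbb{F}_q^{r\times n}$ be the matrix whose entry in row $j$ and column $i$ is $\sum_{\iota=0}^{l_i-1}\gamma_i^{(j-1)q^\iota}/G(\gamma_i^{q^\iota})\in\mathbb{F}_q$ (with $\gamma^0=1$). The matrix $\mathbf{H}^{\mathrm{bin}}$ is obtained from $\mathbf{H}$ by replacing each entry by the length-$m$ column vector of its coordinates over $\mathbb{F}_2$ with respect to some fixed basis of $\mathbb{F}_q=\mathbb{F}_{2^m}$ over $\mathbb{F}_2$. *)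

theory Defs
  imports
    "HOL-Library.Cardinality"
    "HOL-Library.Z2"
    "HOL-Number_Theory.Cong"
    "HOL-Algebra.Algebraic_Closure_Type"
    "Jordan_Normal_Form.DL_Rank"
begin

text \<open>
  \<^typ>\<open>bit\<close> is the field with two elements and \<open>of_bit\<close> its canonical map into another ring. A field
  with \<open>q = 2 ^ m\<close> elements is a type \<open>'a::{field, finite}\<close> with \<open>CARD('a) = 2 ^ m\<close>. The
  polynomials \<open>f\<^sub>1, \<dots>, f\<^sub>n\<close> are indexed from 0, as \<open>f 0, \<dots>, f (n - 1)\<close>.
\<close>

subsection \<open>The code\<close>

definition poly_inverse_mod :: "'a::field poly \<Rightarrow> 'a poly \<Rightarrow> 'a poly" where
  "poly_inverse_mod G f = (THE h. degree h < degree G \<and> [f * h = 1] (mod G))"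

definition goppa_code :: "nat \<Rightarrow> (nat \<Rightarrow> 'a::field poly) \<Rightarrow> 'a poly \<Rightarrow> bit vec set" where
  "goppa_code n f G = {c \<in> carrier_vec n.
     [(\<Sum>i<n. smult (of_bit (c $ i)) (pderiv (f i) * poly_inverse_mod G (f i))) = 0] (mod G)}"

definition code_dim :: "nat \<Rightarrow> bit vec set \<Rightarrow> nat" where
  "code_dim n C = vectorspace.dim class_ring ((module_vec TYPE(bit) n)\<lparr>carrier := C\<rparr>)"

definition hamming_weight :: "bit vec \<Rightarrow> nat" where
  "hamming_weight c = card {i. i < dim_vec c \<and> c $ i \<noteq> 0}"

text \<open>Only meaningful when \<open>C\<close> contains a nonzero word.\<close>

definition min_dist :: "nat \<Rightarrow> bit vec set \<Rightarrow> nat" where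
  "min_dist n C = Min (hamming_weight ` (C - {0\<^sub>v n}))"

subsection \<open>The parity-check matrix\<close>

text \<open>
  All the fields \<open>F\<^bsub>q^l\<^esub>\<close> are taken inside the algebraic closure \<^typ>\<open>'a alg_closure\<close> of \<open>F\<^bsub>q\<^esub>\<close>, where
  a root of an irreducible polynomial of degree \<open>l\<close> over \<open>F\<^bsub>q\<^esub>\<close> automatically lies in \<open>F\<^bsub>q^l\<^esub>\<close>.
  Each entry below is a sum over a full Frobenius orbit, hence in the range of \<^term>\<open>to_ac\<close>, and
  \<^term>\<open>the_inv to_ac\<close> reads it as an element of \<open>F\<^bsub>q\<^esub>\<close>. The row index \<open>j\<close> starts at 0, so the
  exponent is \<open>j\<close> rather than \<open>j - 1\<close>.
\<close>

definition parity_mat ::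
  "nat \<Rightarrow> nat \<Rightarrow> (nat \<Rightarrow> 'a::{field, finite} poly) \<Rightarrow> 'a poly \<Rightarrow> (nat \<Rightarrow> 'a alg_closure) \<Rightarrow> 'a mat"
where
  "parity_mat r n f G \<gamma> = mat r n (\<lambda>(j, i). the_inv to_ac
     (\<Sum>\<iota><degree (f i).
        \<gamma> i ^ (j * CARD('a) ^ \<iota>) / poly (map_poly to_ac G) (\<gamma> i ^ (CARD('a) ^ \<iota>))))"

text \<open>Scalar multiplication of \<open>F\<^bsub>2\<^esub>\<close> on an extension field.\<close>

definition scale2 :: "bit \<Rightarrow> 'a::field \<Rightarrow> 'a" where
  "scale2 c x = of_bit c * x"

definition ordered_basis2 :: "'a::field list \<Rightarrow> bool" where
  "ordered_basis2 bs \<longleftrightarrow> distinct bs \<and> \<not> Modules.module.dependent scale2 (set bs) \<and>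
     Modules.module.span scale2 (set bs) = UNIV"

text \<open>
  Row \<open>j * length bs + t\<close> of the expanded matrix holds the \<open>t\<close>-th coordinates of row \<open>j\<close>.
\<close>

definition binary_expansion :: "'a::field list \<Rightarrow> 'a mat \<Rightarrow> bit mat" where
  "binary_expansion bs H = mat (dim_row H * length bs) (dim_col H) (\<lambda>(k, i).
     Modules.module.representation scale2 (set bs) (H $$ (k div length bs, i)) (bs ! (k mod length bs)))"

subsection \<open>Linearity\<close>

lemma two_eq_0_if_card_power2:
  assumes "CARD('a::{field, finite}) = 2 ^ m"
  shows "(2::'a) = 0"
proof -
  have "(\<Sum>x\<in>(UNIV::'a set). x + 1) = (\<Sum>x\<in>(UNIV::'a set). x)"
    by (rule sum.reindex_bij_witness[of _ "\<lambda>x. x - 1" "\<lambda>x. x + 1"]) auto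
  then have "of_nat CARD('a) = (0::'a)"
    by (simp add: sum.distrib)
  then show ?thesis
    using assms by simp
qed

lemma of_bit_add:
  assumes "(2::'a::field) = 0"
  shows "(of_bit (x + y) :: 'a) = of_bit x + of_bit y"
  using assms by (cases x; cases y) simp_all

lemma vector_space_scale2:
  assumes "CARD('a::{field, finite}) = 2 ^ m"
  shows "vector_space (scale2 :: bit \<Rightarrow> 'a \<Rightarrow> 'a)"
proof
  fix a b :: bit and x y :: 'a
  show "scale2 (a + b) x = scale2 a x + scale2 b x"
    unfolding scale2_def of_bit_add[OF two_eq_0_if_card_power2[OF assms]]
    by (simp only: distrib_right)
  show "scale2 a (scale2 b x) = scale2 (a * b) x"
    unfolding scale2_def by (cases a; cases b) simp_all
next
  fix a :: bit and x y :: 'a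
  show "scale2 a (x + y) = scale2 a x + scale2 a y"
    unfolding scale2_def by (rule distrib_left)
  show "scale2 1 x = x"
    unfolding scale2_def by simp
qed

lemma subspace_goppa_code:
  fixes f :: "nat \<Rightarrow> 'a::{field, finite} poly"
  assumes "CARD('a) = 2 ^ m"
  shows "VectorSpace.subspace class_ring (goppa_code n f G) (module_vec TYPE(bit) n)"
proof -
  interpret vec_space "TYPE(bit)" n .
  define S where
    "S c = (\<Sum>i<n. smult (of_bit (c $ i)) (pderiv (f i) * poly_inverse_mod G (f i)))" for c :: "bit vec"
  have S_add: "S (u + v) = S u + S v" if "u \<in> carrier_vec n" "v \<in> carrier_vec n" for u v
  proof -
    have "S (u + v) = (\<Sum>i<n. smult (of_bit (u $ i + v $ i))
        (pderiv (f i) * poly_inverse_mod G (f i)))"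
      unfolding S_def using that by (intro sum.cong refl) (simp only: lessThan_iff index_add_vec carrier_vecD)
    then show ?thesis
      unfolding S_def of_bit_add[OF two_eq_0_if_card_power2[OF assms]]
      by (simp only: smult_add_left sum.distrib)
  qed
  have S_0: "S (0\<^sub>v n) = 0"
    unfolding S_def by (intro sum.neutral ballI) (simp only: lessThan_iff index_zero_vec, simp)
  have C: "goppa_code n f G = {c \<in> carrier_vec n. S c mod G = 0}"
    unfolding goppa_code_def S_def Cong.cong_def by (simp only: mod_0)
  have closed: "c \<cdot>\<^sub>v v \<in> goppa_code n f G" if "v \<in> goppa_code n f G" for c v
  proof (cases "c = 0")
    case True
    then have "c \<cdot>\<^sub>v v = 0\<^sub>v n" using that by (auto simp: C)
    then show ?thesis by (simp add: C S_0)
  qed (use that in simp)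
  show ?thesis
    unfolding subspace_def
  proof (intro conjI submodule.intro vectorspace_axioms)
    show "goppa_code n f G \<subseteq> carrier V" by (auto simp: C)
    show "\<zero>\<^bsub>V\<^esub> \<in> goppa_code n f G" by (simp add: C S_0)
    show "u \<oplus>\<^bsub>V\<^esub> v \<in> goppa_code n f G" if "u \<in> goppa_code n f G" "v \<in> goppa_code n f G" for u v
      using that by (auto simp: C S_add poly_mod_add_left)
    show "c \<odot>\<^bsub>V\<^esub> v \<in> goppa_code n f G" if "v \<in> goppa_code n f G" for c v
      using closed[OF that] by simp
  qed (rule module_axioms)
qed

end

theory Submission
  imports Defs "Jordan_Normal_Form.Char_Poly"
begin

text \<open>
  Over the algebraic closure, \<open>f\<^sub>i' / f\<^sub>i\<close> is the sum of \<open>1 / (x - \<beta>)\<close> over the roots \<open>\<beta>\<close> of \<open>f\<^sub>i\<close>, which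
  form a Frobenius orbit, and \<open>1 / (x - \<beta>)\<close> is congruent to \<open>- Q\<^sub>\<beta> / G(\<beta>)\<close> modulo \<open>G\<close>, where
  \<open>Q\<^sub>\<beta> = (G(x) - G(\<beta>)) / (x - \<beta>)\<close> has degree less than \<open>r\<close>. So the congruence defining the code
  is the vanishing of a polynomial of degree less than \<open>r\<close>, and a triangular change of coordinates turns its
  coefficients into the rows of \<open>H\<close>; the dimension follows by rank-nullity over \<open>F\<^sub>2\<close>.

  For the distance, let \<open>P\<close> be the product of the \<open>f\<^sub>i\<close> over the support of a nonzero codeword. Then the sum
  of the \<open>f\<^sub>i' / f\<^sub>i\<close> is \<open>P' / P\<close>, so \<open>G\<close> divides \<open>P'\<close>, which is nonzero because the \<open>f\<^sub>i\<close> are separable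
  and pairwise coprime; hence \<open>r < deg P\<close>.
\<close>

section \<open>Bezout identities and inverses modulo a polynomial\<close>

text \<open>A nonzero element \<open>d\<close> of least degree in the ideal generated by
  \<open>f\<close> and \<open>g\<close> divides every member, since remainders modulo
  \<open>d\<close> stay in the ideal. Coprimality makes \<open>d\<close> a unit, and scaling gives
  1.\<close>

lemma coprime_poly_bezout:
  fixes f g :: "'a::field poly"
  assumes "coprime f g"
  obtains a b where "a * f + b * g = 1"
proof -
  define I where "I = {p. \<exists>a b. p = a * f + b * g}"
  have I_mod: "p mod d \<in> I" if p: "p \<in> I" and d: "d \<in> I" for p d
  proof -
    obtain a b a' b' where *: "p = a * f + b * g" "d = a' * f + b' * g"
      using p d by (auto simp: I_def)
    define e where "e = p div d"
    have "p mod d = p - e * d"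
      unfolding e_def by (rule minus_div_mult_eq_mod[symmetric])
    also have "\<dots> = (a - e * a') * f + (b - e * b') * g"
      unfolding * by (simp add: algebra_simps)
    finally show ?thesis
      unfolding I_def by blast
  qed
  have fI: "f \<in> I" and gI: "g \<in> I"
    unfolding I_def by (auto intro: exI[of _ 1] exI[of _ 0])
  have "\<exists>d. d \<in> I \<and> d \<noteq> 0"
    using assms fI gI by (metis coprime_0_left_iff not_is_unit_0)
  then obtain d where d: "d \<in> I" "d \<noteq> 0" and min: "\<And>e. e \<in> I \<Longrightarrow> e \<noteq> 0 \<Longrightarrow> degree d \<le> degree e"
    using ex_has_least_nat[of "\<lambda>d. d \<in> I \<and> d \<noteq> 0" _ degree] by blast
  have "d dvd p" if "p \<in> I" for p
    using min[OF I_mod[OF that d(1)]] degree_mod_less'[OF d(2), of p]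
    by (meson dvd_eq_mod_eq_0 not_le)
  then have "is_unit d"
    using assms fI gI coprime_common_divisor by blast
  then obtain e where e: "1 = d * e"
    by blast
  obtain a b where "d = a * f + b * g"
    using d by (auto simp: I_def)
  then have "(e * a) * f + (e * b) * g = 1"
    using e by (simp add: algebra_simps)
  then show ?thesis
    by (rule that)
qed

text \<open>A Bezout coefficient of \<open>f\<close>, reduced modulo \<open>G\<close>, is an
  inverse. Uniqueness is established as well because \<open>poly_inverse_mod\<close> is a definite
  description.\<close>

lemma poly_inverse_mod_cong:
  fixes f G :: "'a::field poly"
  assumes "coprime f G" and "degree G > 0"
  shows "[f * poly_inverse_mod G f = 1] (mod G)"
proof -
  have "G \<noteq> 0"
    using assms(2) by auto
  obtain a b where ab: "a * f + b * G = 1"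
    using coprime_poly_bezout[OF assms(1)] .
  then have "f * a = 1 + (- b) * G"
    by (simp add: algebra_simps eq_diff_eq)
  then have inv: "[f * a = 1] (mod G)"
    by (metis Cong.cong_def mod_mult_self1)
  have "\<exists>!h. degree h < degree G \<and> [f * h = 1] (mod G)"
  proof (rule ex1I[of _ "a mod G"])
    show "degree (a mod G) < degree G \<and> [f * (a mod G) = 1] (mod G)"
      using degree_mod_less'[OF \<open>G \<noteq> 0\<close>, of a] assms(2) inv
      by (cases "a mod G = 0") (auto simp: Cong.cong_def mod_mult_right_eq)
  next
    fix h assume h: "degree h < degree G \<and> [f * h = 1] (mod G)"
    \<comment> \<open>Evaluating the product of \<open>a\<close>, \<open>f\<close> and
      \<open>h\<close> in two ways shows that any inverse \<open>h\<close> is congruent to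
      \<open>a\<close>.\<close>
    have "[a * (f * h) = a * 1] (mod G)"
      using h by (intro cong_mult) auto
    moreover have "[f * a * h = 1 * h] (mod G)"
      using inv by (intro cong_mult) auto
    ultimately have "[h = a] (mod G)"
      unfolding Cong.cong_def by (metis mult.assoc mult.commute mult.right_neutral)
    then show "h = a mod G"
      using h by (simp add: Cong.cong_def mod_poly_less)
  qed
  from theI'[OF this] show ?thesis
    unfolding poly_inverse_mod_def by blast
qed

subsection \<open>Frobenius orbits\<close>

text \<open>Multiplication by a nonzero \<open>x\<close> permutes the nonzero elements, so their
  product absorbs the factor \<open>x ^ (CARD('a) - 1)\<close> without changing.\<close>

lemma finite_field_power_card:
  fixes x :: "'a::{field, finite}"
  shows "x ^ CARD('a) = x"
proof (cases "x = 0")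
  case False
  have "(\<Prod>y\<in>UNIV - {0}. x * y) = (\<Prod>y\<in>UNIV - {0}. y)"
    by (rule prod.reindex_bij_witness[of _ "\<lambda>y. y / x" "\<lambda>y. x * y"]) (use False in auto)
  then have "x ^ (CARD('a) - 1) * \<Prod>(UNIV - {0 :: 'a}) = \<Prod>(UNIV - {0 :: 'a})"
    by (simp add: prod.distrib)
  then have "x ^ (CARD('a) - 1) = 1"
    by simp
  then have "x ^ Suc (CARD('a) - 1) = x"
    by (simp only: power_Suc mult_1_right)
  then show ?thesis
    using zero_less_card_finite[where 'a = 'a] by (simp only: Suc_diff_1)
qed simp

interpretation to_ac: field_hom "to_ac :: 'a::field \<Rightarrow> 'a alg_closure"
  by unfold_locales simp_all

interpretation map_to_ac: map_poly_inj_idom_hom "to_ac :: 'a::field \<Rightarrow> 'a alg_closure" ..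

text \<open>With \<open>q = CARD('a)\<close>, the \<open>q\<close> embedded elements are roots of
  \<open>X ^ q - X\<close>, which has at most \<open>q\<close> roots.\<close>

lemma range_to_ac_finite_field:
  "range (to_ac :: 'a::{field, finite} \<Rightarrow> _) = {x. x ^ CARD('a) = x}"
proof (rule card_subset_eq)
  define P :: "'a alg_closure poly" where "P = Polynomial.monom 1 CARD('a) - [:0, 1:]"
  \<comment> \<open>This bound lets the monomial of degree \<open>CARD('a)\<close> dominate the
    linear term of \<open>P\<close>.\<close>
  have "CARD('a) > 1"
    using card_mono[of UNIV "{0, 1 :: 'a}"] by auto
  then have deg: "degree P = CARD('a)"
    unfolding P_def diff_conv_add_uminus by (subst degree_add_eq_left) (auto simp: degree_monom_eq)
  then have "P \<noteq> 0"
    by auto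
  have roots: "{x. x ^ CARD('a) = x} = {x. poly P x = 0}"
    by (auto simp: P_def poly_monom)
  show "finite {x :: 'a alg_closure. x ^ CARD('a) = x}"
    unfolding roots by (rule poly_roots_finite[OF \<open>P \<noteq> 0\<close>])
  show sub: "range (to_ac :: 'a \<Rightarrow> _) \<subseteq> {x. x ^ CARD('a) = x}"
    by (auto simp: finite_field_power_card simp flip: to_ac_power)
  have "card (range (to_ac :: 'a \<Rightarrow> _)) = CARD('a)"
    by (rule card_image[OF inj_to_ac])
  moreover have "card {x :: 'a alg_closure. x ^ CARD('a) = x} \<le> CARD('a)"
    unfolding roots using card_poly_roots_bound[OF \<open>P \<noteq> 0\<close>] deg by simp
  ultimately show "card (range (to_ac :: 'a \<Rightarrow> _)) = card {x :: 'a alg_closure. x ^ CARD('a) = x}"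
    using card_mono[OF \<open>finite {x :: 'a alg_closure. x ^ CARD('a) = x}\<close> sub] by linarith
qed

lemma CHAR_eq_2_if_card_power2:
  assumes "CARD('a::{field, finite}) = 2 ^ m"
  shows "CHAR('a) = 2"
  by (rule CHAR_eq_posI)
    (use two_eq_0_if_card_power2[OF assms] in \<open>auto simp: less_Suc_eq numeral_2_eq_2\<close>)

text \<open>The exponent equals \<open>2 ^ (m * k)\<close>, a power of the characteristic, so
  raising to it is additive.\<close>

lemma field_hom_frobenius:
  assumes "CARD('a::{field, finite}) = 2 ^ m"
  shows "field_hom (\<lambda>x :: 'a alg_closure. x ^ CARD('a) ^ k)"
proof unfold_locales
  fix x y :: "'a alg_closure"
  show "(x + y) ^ CARD('a) ^ k = x ^ CARD('a) ^ k + y ^ CARD('a) ^ k"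
    by (rule freshmans_dream'[where n = "m * k"])
      (simp_all add: CHAR_eq_2_if_card_power2[OF assms] assms power_mult)
qed (simp_all add: power_mult_distrib)


lemma irreducible_field_poly_coprime:
  fixes f g :: "'a::field poly"
  assumes "Factorial_Ring.irreducible f" and "\<not> f dvd g"
  shows "coprime f g"
proof (rule coprimeI)
  fix d assume d: "d dvd f" "d dvd g"
  then obtain e where e: "f = d * e"
    by blast
  then consider "is_unit d" | "is_unit e"
    using assms(1) by (auto dest: Factorial_Ring.irreducibleD)
  then show "is_unit d"
  proof cases
    case 2
    then have "f dvd d"
      using e by (metis mult_unit_dvd_iff dvd_refl)
    then show ?thesis
      using assms(2) d(2) dvd_trans by blast
  qed
qed

lemma irreducible_field_poly_degree_pos:
  fixes f :: "'a::field poly"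
  assumes "Factorial_Ring.irreducible f"
  shows "degree f > 0"
  using assms is_unit_iff_degree[of f] by (auto simp: Factorial_Ring.irreducible_def)

context
  fixes m :: nat
  assumes card: "CARD('a::{field, finite}) = 2 ^ m"
begin

interpretation frob: field_hom "\<lambda>x :: 'a alg_closure. x ^ CARD('a) ^ k" for k
  by (rule field_hom_frobenius[OF card])

lemma frobenius_power_eq_iff:
  fixes x y :: "'a alg_closure"
  shows "x ^ CARD('a) ^ k = y ^ CARD('a) ^ k \<longleftrightarrow> x = y"
  using frob.injectivity by blast

lemma map_poly_frobenius_to_ac:
  "map_poly (\<lambda>x. x ^ CARD('a) ^ k) (map_poly to_ac (p :: 'a poly)) = map_poly to_ac p"
proof -
  have "to_ac a ^ CARD('a) ^ k = to_ac a" for a :: 'a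
    by (induction k) (simp_all add: power_mult finite_field_power_card flip: to_ac_power)
  then show ?thesis
    by (intro poly_eqI) (simp add: coeff_map_poly)
qed

text \<open>Frobenius fixes the coefficients of \<open>p\<close>, so it commutes with evaluation; in
  particular it sends roots of \<open>p\<close> to roots.\<close>

lemma poly_to_ac_frobenius:
  "poly (map_poly to_ac (p :: 'a poly)) (x ^ CARD('a) ^ k) = poly (map_poly to_ac p) x ^ CARD('a) ^ k"
proof -
  have "poly (map_poly to_ac p) (x ^ CARD('a) ^ k)
      = poly (map_poly (\<lambda>x. x ^ CARD('a) ^ k) (map_poly to_ac p)) (x ^ CARD('a) ^ k)"
    by (simp only: map_poly_frobenius_to_ac)
  also have "\<dots> = poly (map_poly to_ac p) x ^ CARD('a) ^ k"
    by (rule frob.poly_map_poly)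
  finally show ?thesis .
qed

text \<open>Galois descent: a coefficient fixed by the \<open>q\<close>-th power map lies in the
  embedded base field and can be pulled back.\<close>

lemma frobenius_fixed_poly:
  assumes "map_poly (\<lambda>x. x ^ CARD('a)) p = p"
  obtains p' where "p = map_poly to_ac (p' :: 'a poly)"
proof
  have "coeff p n ^ CARD('a) = coeff p n" for n
    using arg_cong[OF assms, of "\<lambda>p. coeff p n"] by (simp add: coeff_map_poly)
  then have "coeff p n \<in> range (to_ac :: 'a \<Rightarrow> _)" for n
    by (simp add: range_to_ac_finite_field)
  then show "p = map_poly to_ac (map_poly of_ac p)"
    by (intro poly_eqI) (simp add: coeff_map_poly to_ac_of_ac)
qed

text \<open>Let \<open>d\<close> be the least period of \<gamma> under Frobenius. The product
  \<open>P\<close> of the linear factors over the orbit is Frobenius-invariant, so it descends to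
  F_q and is divisible by \<open>f\<close>. Conversely, the \<open>d\<close> distinct conjugates are
  roots of \<open>f\<close>. Hence \<open>d = degree f\<close>, and \<open>P\<close> is proportional
  to \<open>f\<close>.\<close>

lemma frobenius_orbit:
  fixes f :: "'a poly" and \<gamma> :: "'a alg_closure"
  assumes irr: "Factorial_Ring.irreducible f" and root: "poly (map_poly to_ac f) \<gamma> = 0"
  shows frobenius_orbit_period: "\<gamma> ^ CARD('a) ^ degree f = \<gamma>"
    and inj_on_frobenius_orbit: "inj_on (\<lambda>\<iota>. \<gamma> ^ CARD('a) ^ \<iota>) {..<degree f}"
    and irreducible_splits_frobenius_orbit:
      "map_poly to_ac f = smult (to_ac (lead_coeff f)) (\<Prod>\<iota><degree f. [:- (\<gamma> ^ CARD('a) ^ \<iota>), 1:])"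
proof -
  define q where "q = CARD('a)"
  define g where "g \<iota> = \<gamma> ^ q ^ \<iota>" for \<iota>
  define F where "F = map_poly to_ac f"
  have "f \<noteq> 0"
    using irr by auto
  then have "F \<noteq> 0"
    unfolding F_def by simp
  have g_add: "g (i + j) = g i ^ q ^ j" for i j
    by (simp add: g_def power_add power_mult)
  have F_root: "poly F (g i) = 0" for i
    unfolding F_def g_def q_def poly_to_ac_frobenius root by (simp add: zero_power)
  \<comment> \<open>Frobenius is injective, so a coincidence can be shifted back to the start of the
    orbit.\<close>
  have period: "g (j - i) = \<gamma>" if "i < j" "g i = g j" for i j
  proof -
    have "g (j - i) ^ q ^ i = \<gamma> ^ q ^ i"
      using that g_add[of "j - i" i] by (simp add: g_def)
    then show ?thesis
      unfolding q_def frobenius_power_eq_iff .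
  qed
  \<comment> \<open>The orbit stays in the finite root set of \<open>F\<close>, so it must
    repeat.\<close>
  have "\<not> inj g"
  proof
    assume "inj g"
    then have "infinite (range g)"
      by (rule range_inj_infinite)
    moreover have "range g \<subseteq> {x. poly F x = 0}"
      using F_root by auto
    ultimately show False
      using poly_roots_finite[OF \<open>F \<noteq> 0\<close>] finite_subset by blast
  qed
  then obtain i j where "i < j" "g i = g j"
    unfolding inj_def by (metis linorder_neqE_nat)
  then have ex: "\<exists>d. d > 0 \<and> g d = \<gamma>"
    using period by (intro exI[of _ "j - i"]) auto
  define d where "d = (LEAST d. d > 0 \<and> g d = \<gamma>)"
  have d: "d > 0" "g d = \<gamma>"
    using LeastI_ex[OF ex] by (auto simp: d_def)
  have d_le: "d \<le> e" if "e > 0" "g e = \<gamma>" for e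
    unfolding d_def using that by (intro Least_le) auto
  have inj: "inj_on g {..<d}"
  proof (rule linorder_inj_onI')
    fix i j assume "i \<in> {..<d}" "j \<in> {..<d}" "i < j"
    then show "g i \<noteq> g j"
      using period[of i j] d_le[of "j - i"] by fastforce
  qed
  define P where "P = (\<Prod>\<iota><d. [:- g \<iota>, 1:])"
  have "map_poly (\<lambda>x. x ^ q) P = (\<Prod>\<iota><d. [:- g (Suc \<iota>), 1:])"
  proof -
    interpret frob1: field_hom "\<lambda>x :: 'a alg_closure. x ^ q"
      using field_hom_frobenius[OF card, of 1] by (simp add: q_def)
    interpret map_frob1: map_poly_idom_hom "\<lambda>x :: 'a alg_closure. x ^ q" ..
    have "map_poly (\<lambda>x. x ^ q) [:- g \<iota>, 1:] = [:- g (Suc \<iota>), 1:]" for \<iota>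
      using g_add[of \<iota> 1] by (simp add: frob1.map_poly_pCons_hom frob1.hom_uminus)
    then show ?thesis
      unfolding P_def map_frob1.hom_prod by simp
  qed
  also have "\<dots> = P"
  proof -
    \<comment> \<open>In the product over \<open>d + 1\<close> indices the first and last factors
      agree, as \<open>g d = g 0\<close>; splitting off either one and cancelling identifies the
      shifted product with \<open>P\<close>.\<close>
    have "[:- g 0, 1:] * (\<Prod>\<iota><d. [:- g (Suc \<iota>), 1:]) = (\<Prod>\<iota><Suc d. [:- g \<iota>, 1:])"
      by (rule prod.lessThan_Suc_shift[symmetric])
    also have "\<dots> = [:- g 0, 1:] * P"
      using d(2) by (simp add: P_def g_def)
    finally show ?thesis
      by (subst (asm) mult_cancel_left) simp
  qed
  finally obtain p where p: "P = map_poly to_ac p"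
    unfolding q_def by (rule frobenius_fixed_poly)
  have "P \<noteq> 0"
    by (simp add: P_def)
  have deg_P: "degree P = d"
    unfolding P_def by (subst degree_prod_eq_sum_degree) auto
  \<comment> \<open>Otherwise a Bezout identity for \<open>f\<close> and \<open>p\<close>, evaluated
    at their common root \<gamma>, would read 0 = 1.\<close>
  have "f dvd p"
  proof (rule ccontr)
    assume "\<not> f dvd p"
    then obtain a b where ab: "a * f + b * p = 1"
      using coprime_poly_bezout irreducible_field_poly_coprime[OF irr] by metis
    have "poly P \<gamma> = 0"
      using d(1) unfolding P_def poly_prod by (subst prod_zero_iff) (auto intro!: bexI[of _ 0] simp: g_def)
    then have "poly (map_poly to_ac (a * f + b * p)) \<gamma> = 0"
      using root p by (simp add: map_to_ac.hom_add map_to_ac.hom_mult)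
    then show False
      unfolding ab by simp
  qed
  then have dvd: "F dvd P"
    unfolding p F_def by (rule map_to_ac.hom_dvd)
  have "d = card (g ` {..<d})"
    by (simp add: card_image[OF inj])
  also have "\<dots> \<le> card {x. poly F x = 0}"
    using F_root by (intro card_mono poly_roots_finite \<open>F \<noteq> 0\<close>) auto
  also have "\<dots> \<le> degree f"
    using card_poly_roots_bound[OF \<open>F \<noteq> 0\<close>] by (simp add: F_def)
  finally have "d \<le> degree f" .
  moreover have "degree f \<le> d"
    using dvd_imp_degree_le[OF dvd \<open>P \<noteq> 0\<close>] deg_P by (simp add: F_def)
  ultimately have d_eq: "d = degree f"
    by simp
  obtain h where h: "P = F * h"
    using dvd by blast
  then have "h \<noteq> 0"
    using \<open>P \<noteq> 0\<close> by auto
  then have "degree h = 0"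
    using h \<open>F \<noteq> 0\<close> deg_P d_eq by (simp add: degree_mult_eq F_def)
  then obtain c where c: "h = [:c:]"
    by (rule degree_eq_zeroE)
  \<comment> \<open>\<open>P\<close> is monic, which determines the constant \<open>c\<close>
    relating it to \<open>F\<close>.\<close>
  have "lead_coeff P = 1"
    unfolding P_def by (simp add: lead_coeff_prod)
  then have "lead_coeff F * lead_coeff h = 1"
    unfolding h lead_coeff_mult .
  then have "to_ac (lead_coeff f) * c = 1"
    by (simp add: c F_def)
  then have "F = smult (to_ac (lead_coeff f)) P"
    unfolding h c by (simp add: mult.commute)
  then show "map_poly to_ac f = smult (to_ac (lead_coeff f)) (\<Prod>\<iota><degree f. [:- (\<gamma> ^ CARD('a) ^ \<iota>), 1:])"
    by (simp add: F_def P_def d_eq g_def q_def)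
  show "\<gamma> ^ CARD('a) ^ degree f = \<gamma>"
    using d(2) by (simp add: d_eq g_def q_def)
  show "inj_on (\<lambda>\<iota>. \<gamma> ^ CARD('a) ^ \<iota>) {..<degree f}"
    using inj by (simp add: d_eq g_def [abs_def] q_def)
qed

end

text \<open>A common root would turn a Bezout identity into 0 = 1. This keeps the denominators in
  the parity checks nonzero.\<close>

lemma poly_root_ne_0_if_coprime:
  assumes "coprime f G" and "poly (map_poly to_ac f) x = 0"
  shows "poly (map_poly to_ac G) x \<noteq> 0"
proof
  assume *: "poly (map_poly to_ac G) x = 0"
  obtain a b where ab: "a * f + b * G = 1"
    using coprime_poly_bezout[OF assms(1)] .
  have "poly (map_poly to_ac (a * f + b * G)) x = 0"
    using assms(2) * by (simp add: map_to_ac.hom_add map_to_ac.hom_mult)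
  then show False
    unfolding ab by simp
qed

text \<open>The \<open>q\<close>-th power map permutes the terms of this trace cyclically, so it
  fixes the sum.\<close>

lemma frobenius_orbit_sum_in_range:
  fixes z :: "'a::{field, finite} alg_closure"
  assumes "CARD('a) = 2 ^ m" and "z ^ CARD('a) ^ l = z"
  shows "(\<Sum>\<iota><l. z ^ CARD('a) ^ \<iota>) \<in> range to_ac"
proof -
  interpret frob: field_hom "\<lambda>x :: 'a alg_closure. x ^ CARD('a)"
    using field_hom_frobenius[OF assms(1), of 1] by simp
  have "(\<Sum>\<iota><l. z ^ CARD('a) ^ \<iota>) ^ CARD('a) = (\<Sum>\<iota><l. z ^ CARD('a) ^ Suc \<iota>)"
    unfolding frob.hom_sum by (simp add: power_mult mult.commute flip: power_mult)
  also have "\<dots> = (\<Sum>\<iota><l. z ^ CARD('a) ^ \<iota>)"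
    using sum.lessThan_Suc_shift[of "\<lambda>\<iota>. z ^ CARD('a) ^ \<iota>" l] assms(2)
    by (simp add: add.commute)
  finally show ?thesis
    unfolding range_to_ac_finite_field by simp
qed

text \<open>The sum is the trace of \<open>z\<close>, so it lies in the range of
  \<open>to_ac\<close>, where \<open>the_inv to_ac\<close> really inverts the embedding.\<close>

lemma to_ac_parity_mat:
  fixes f :: "nat \<Rightarrow> 'a::{field, finite} poly"
  assumes "CARD('a) = 2 ^ m" and "Factorial_Ring.irreducible (f i)"
    and "poly (map_poly to_ac (f i)) (\<gamma> i) = 0" and "j < r" and "i < n"
  shows "to_ac (parity_mat r n f G \<gamma> $$ (j, i)) =
    (\<Sum>\<iota><degree (f i). (\<gamma> i ^ CARD('a) ^ \<iota>) ^ j / poly (map_poly to_ac G) (\<gamma> i ^ CARD('a) ^ \<iota>))"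
proof -
  note root = assms(1-3)
  define z where "z = \<gamma> i ^ j / poly (map_poly to_ac G) (\<gamma> i)"
  have z: "(\<gamma> i ^ CARD('a) ^ k) ^ j / poly (map_poly to_ac G) (\<gamma> i ^ CARD('a) ^ k) = z ^ CARD('a) ^ k" for k
    unfolding z_def poly_to_ac_frobenius[OF assms(1)] power_divide
    by (simp add: mult.commute flip: power_mult)
  have "z ^ CARD('a) ^ degree (f i) = z"
    unfolding z[symmetric] frobenius_orbit_period[OF root] by (simp add: z_def)
  then have "(\<Sum>\<iota><degree (f i). z ^ CARD('a) ^ \<iota>) \<in> range to_ac"
    by (rule frobenius_orbit_sum_in_range[OF assms(1)])
  moreover have "parity_mat r n f G \<gamma> $$ (j, i) = the_inv to_ac (\<Sum>\<iota><degree (f i). z ^ CARD('a) ^ \<iota>)"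
    using assms(4,5)
    by (simp add: parity_mat_def power_mult mult.commute flip: z)
      (simp add: mult.commute flip: power_mult)
  ultimately show ?thesis
    by (simp add: z f_the_inv_into_f[OF inj_to_ac])
qed

subsection \<open>Logarithmic derivatives and parity checks\<close>

text \<open>By the product rule \<open>pderiv F\<close> is the sum of the cofactors
  \<open>M k\<close> of \<open>X - b k\<close>, and \<open>M k * H\<close> inverts
  \<open>X - b k\<close> modulo \<open>G\<close>. Since \<open>synthetic_div G b\<close> is
  \<open>(G - G(b)) / (X - b)\<close>, its quotient by \<open>- G(b)\<close> is an inverse of
  \<open>X - b\<close> too.\<close>

lemma log_deriv_cong_synthetic_div:
  fixes F G H :: "'a::field poly"
  assumes "finite I" and F: "F = smult c (\<Prod>k\<in>I. [:- b k, 1:])"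
    and H: "[F * H = 1] (mod G)" and G: "\<And>k. k \<in> I \<Longrightarrow> poly G (b k) \<noteq> 0"
  shows "[pderiv F * H = - (\<Sum>k\<in>I. smult (1 / poly G (b k)) (synthetic_div G (b k)))] (mod G)"
proof -
  define M where "M k = smult c (\<Prod>j\<in>I - {k}. [:- b j, 1:])" for k
  have "pderiv F = (\<Sum>k\<in>I. M k)"
    unfolding F M_def pderiv_smult pderiv_prod by (simp add: pderiv_pCons smult_sum2)
  then have eq: "pderiv F * H + (\<Sum>k\<in>I. smult (1 / poly G (b k)) (synthetic_div G (b k)))
      = (\<Sum>k\<in>I. M k * H + smult (1 / poly G (b k)) (synthetic_div G (b k)))"
    by (simp add: sum_distrib_right sum.distrib)
  have "G dvd M k * H + smult (1 / poly G (b k)) (synthetic_div G (b k))" if k: "k \<in> I" for k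
  proof -
    define Q where "Q = smult (1 / poly G (b k)) (synthetic_div G (b k))"
    have F_M: "F = [:- b k, 1:] * M k"
      unfolding F M_def using prod.remove[OF \<open>finite I\<close> k, of "\<lambda>k. [:- b k, 1:]"] by simp
    have "[:- b k, 1:] * Q = smult (1 / poly G (b k)) ([:- b k, 1:] * synthetic_div G (b k))"
      by (simp only: Q_def mult_smult_right)
    also have "[:- b k, 1:] * synthetic_div G (b k) = G - [:poly G (b k):]"
      using synthetic_div_correct'[of "b k" G] by (simp only: eq_diff_eq)
    finally have Q: "[:- b k, 1:] * Q = smult (1 / poly G (b k)) G - 1"
      using G[OF k] by (simp add: smult_diff_right one_pCons)
    obtain e where e: "F * H - 1 = G * e"
      using H unfolding cong_iff_dvd_diff by (rule dvdE)
    \<comment> \<open>The rewriting exposes \<open>[:- b k, 1:] * Q + 1\<close> and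
      \<open>F * H - 1\<close>, each a multiple of \<open>G\<close>.\<close>
    have "M k * H + Q = ([:- b k, 1:] * Q + 1) * (M k * H) - Q * (F * H - 1)"
      unfolding F_M by (simp add: algebra_simps)
    also have "\<dots> = G * (smult (1 / poly G (b k)) (M k * H) - Q * e)"
      unfolding Q e by (simp add: algebra_simps)
    finally show ?thesis
      unfolding Q_def by simp
  qed
  then have "G dvd pderiv F * H - - (\<Sum>k\<in>I. smult (1 / poly G (b k)) (synthetic_div G (b k)))"
    unfolding diff_minus_eq_add eq by (rule dvd_sum)
  then show ?thesis
    by (simp only: cong_iff_dvd_diff)
qed

text \<open>Horner's recursion unrolled from the top degree downwards; in the base case
  \<open>degree p \<le> n\<close> both sides vanish.\<close>

lemma coeff_synthetic_div:
  fixes p :: "'a::comm_ring_1 poly"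
  shows "coeff (synthetic_div p c) n = (\<Sum>i<degree p - n. coeff p (Suc n + i) * c ^ i)"
proof (induction "degree p - n" arbitrary: n)
  case 0
  then have "coeff (synthetic_div p c) n = 0"
    by (cases "degree p = 0") (auto simp: synthetic_div_eq_0_iff[THEN iffD2] degree_synthetic_div
        intro: coeff_eq_0)
  then show ?case
    using 0 by simp
next
  case (Suc k)
  have "coeff (synthetic_div p c) n = coeff p (Suc n) + c * coeff (synthetic_div p c) (Suc n)"
    using arg_cong[OF synthetic_div_correct[of p c], of "\<lambda>p. coeff p (Suc n)"] by simp
  also have "degree p - n = Suc (degree p - Suc n)"
    using Suc by simp
  then have "coeff p (Suc n) + c * coeff (synthetic_div p c) (Suc n)
      = (\<Sum>i<degree p - n. coeff p (Suc n + i) * c ^ i)"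
    using Suc(1)[of "Suc n"] Suc(2)
    by (simp add: sum.lessThan_Suc_shift sum_distrib_left mult_ac del: sum.lessThan_Suc)
  finally show ?case .
qed

text \<open>
  The coefficients of \<^term>\<open>synthetic_div G c\<close> arise from \<open>c ^ 0, \<dots>, c ^ (degree G - 1)\<close> by an
  anti-triangular matrix with \<^term>\<open>lead_coeff G\<close> on the antidiagonal.
\<close>
lemma sum_synthetic_div_eq_0_iff:
  fixes w b :: "'k \<Rightarrow> 'a::field"
  shows "(\<Sum>k\<in>K. smult (w k) (synthetic_div G (b k))) = 0 \<longleftrightarrow>
    (\<forall>j<degree G. (\<Sum>k\<in>K. w k * b k ^ j) = 0)"
proof -
  define s where "s j = (\<Sum>k\<in>K. w k * b k ^ j)" for j
  define A where "A = (\<Sum>k\<in>K. smult (w k) (synthetic_div G (b k)))"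
  have coeff_A: "coeff A n = (\<Sum>i<degree G - n. coeff G (Suc n + i) * s i)" for n
    unfolding A_def s_def coeff_sum coeff_smult coeff_synthetic_div sum_distrib_left
    by (subst sum.swap) (simp add: mult_ac)
  \<comment> \<open>The coefficient of index \<open>degree G - 1 - j\<close> involves only
    \<open>s 0, ..., s j\<close>, with \<open>s j\<close> multiplied by the leading coefficient;
    strong induction removes the earlier terms.\<close>
  have "s j = 0" if "A = 0" "j < degree G" for j
    using that(2)
  proof (induction j rule: less_induct)
    case (less j)
    have "degree G - (degree G - Suc j) = Suc j"
      using less.prems by simp
    then have "0 = (\<Sum>i<Suc j. coeff G (Suc (degree G - Suc j) + i) * s i)"
      using coeff_A[of "degree G - Suc j"] \<open>A = 0\<close> by simp
    also have "\<dots> = coeff G (degree G) * s j"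
      using less.prems less.IH by simp
    finally show ?case
      using less.prems by auto
  qed
  moreover have "A = 0" if "\<And>j. j < degree G \<Longrightarrow> s j = 0"
    using that by (intro poly_eqI) (simp add: coeff_A)
  ultimately show ?thesis
    unfolding A_def s_def by blast
qed

lemma sum_Sigma_fst_snd:
  assumes "finite A" and "\<And>x. x \<in> A \<Longrightarrow> finite (B x)"
  shows "(\<Sum>k\<in>Sigma A B. h (fst k) (snd k)) = (\<Sum>x\<in>A. \<Sum>y\<in>B x. h x y)"
  using assms by (simp add: sum.Sigma split_def)

lemma to_ac_of_bool [simp]: "to_ac (of_bool b) = of_bool b"
  by (cases b) simp_all

text \<open>Over the closure the sum defining the code is congruent to \<open>- A\<close>, where
  \<open>A\<close> combines synthetic quotients over all roots of all \<open>f i\<close>. Its degree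
  is below that of \<open>G\<close>, so divisibility forces \<open>A = 0\<close>, that is, weighted
  power sums vanish; grouping them by \<open>i\<close> yields the rows of
  \<open>parity_mat\<close>.\<close>

lemma goppa_code_parity_checks:
  fixes f :: "nat \<Rightarrow> 'a::{field, finite} poly"
  assumes card: "CARD('a) = 2 ^ m" and deg: "degree G > 0"
    and irr: "\<And>i. i < n \<Longrightarrow> Factorial_Ring.irreducible (f i)"
    and cop: "\<And>i. i < n \<Longrightarrow> coprime (f i) G"
    and root: "\<And>i. i < n \<Longrightarrow> poly (map_poly to_ac (f i)) (\<gamma> i) = 0"
  shows "goppa_code n f G = {c \<in> carrier_vec n.
    \<forall>j<degree G. (\<Sum>i<n. of_bit (c $ i) * parity_mat (degree G) n f G \<gamma> $$ (j, i)) = 0}"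
proof -
  define G' where "G' = map_poly to_ac G"
  define b where "b i \<iota> = \<gamma> i ^ CARD('a) ^ \<iota>" for i \<iota>
  have deg_G': "degree G' = degree G"
    by (simp add: G'_def)
  have "[(\<Sum>i<n. smult (of_bit (c $ i)) (pderiv (f i) * poly_inverse_mod G (f i))) = 0] (mod G) \<longleftrightarrow>
      (\<forall>j<degree G. (\<Sum>i<n. of_bit (c $ i) * parity_mat (degree G) n f G \<gamma> $$ (j, i)) = 0)"
    (is "?L \<longleftrightarrow> ?R") for c :: "bit vec"
  proof -
    \<comment> \<open>An element of \<open>K\<close> names one root: a polynomial index and a
      position in its Frobenius orbit.\<close>
    define K where "K = (SIGMA i:{..<n}. {..<degree (f i)})"
    define w where "w k = of_bit (c $ fst k) / poly G' (b (fst k) (snd k))" for k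
    define T where "T = (\<Sum>i<n. smult (of_bit (c $ i)) (pderiv (f i) * poly_inverse_mod G (f i)))"
    define A where "A = (\<Sum>k\<in>K. smult (w k) (synthetic_div G' (b (fst k) (snd k))))"
    have term_cong: "[map_poly to_ac (pderiv (f i) * poly_inverse_mod G (f i)) =
        - (\<Sum>\<iota><degree (f i). smult (1 / poly G' (b i \<iota>)) (synthetic_div G' (b i \<iota>)))] (mod G')"
      if i: "i < n" for i
      unfolding map_to_ac.hom_mult to_ac.map_poly_pderiv
    proof (rule log_deriv_cong_synthetic_div)
      show "map_poly to_ac (f i) = smult (to_ac (lead_coeff (f i))) (\<Prod>\<iota><degree (f i). [:- b i \<iota>, 1:])"
        unfolding b_def by (rule irreducible_splits_frobenius_orbit[OF card irr[OF i] root[OF i]])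
      have "G dvd f i * poly_inverse_mod G (f i) - 1"
        using poly_inverse_mod_cong[OF cop[OF i] deg] by (simp only: cong_iff_dvd_diff)
      then have "G' dvd map_poly to_ac (f i * poly_inverse_mod G (f i) - 1)"
        unfolding G'_def by (rule map_to_ac.hom_dvd)
      then show "[map_poly to_ac (f i) * map_poly to_ac (poly_inverse_mod G (f i)) = 1] (mod G')"
        by (simp add: cong_iff_dvd_diff map_to_ac.hom_minus map_to_ac.hom_mult)
      show "poly G' (b i \<iota>) \<noteq> 0" if "\<iota> \<in> {..<degree (f i)}" for \<iota>
        unfolding G'_def b_def poly_to_ac_frobenius[OF card]
        using poly_root_ne_0_if_coprime[OF cop[OF i] root[OF i]] by simp
    qed simp
    have "map_poly to_ac T = (\<Sum>i<n. [:of_bit (c $ i):] * map_poly to_ac (pderiv (f i) * poly_inverse_mod G (f i)))"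
      unfolding T_def map_to_ac.hom_sum by (simp add: to_ac.map_poly_hom_smult)
    also have "[\<dots> = (\<Sum>i<n. [:of_bit (c $ i):] *
        - (\<Sum>\<iota><degree (f i). smult (1 / poly G' (b i \<iota>)) (synthetic_div G' (b i \<iota>))))] (mod G')"
      by (intro cong_sum cong_mult cong_refl term_cong) simp
    also have "(\<Sum>i<n. [:of_bit (c $ i):] *
        - (\<Sum>\<iota><degree (f i). smult (1 / poly G' (b i \<iota>)) (synthetic_div G' (b i \<iota>)))) = - A"
      unfolding A_def K_def w_def
      by (subst sum_Sigma_fst_snd[where h = "\<lambda>i \<iota>. smult (of_bit (c $ i) / poly G' (b i \<iota>)) (synthetic_div G' (b i \<iota>))"])
        (simp_all add: smult_sum2 sum_negf)
    finally have T_cong: "[map_poly to_ac T = - A] (mod G')" .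
    have "?L \<longleftrightarrow> G dvd T"
      unfolding T_def by (simp only: cong_0_iff)
    \<comment> \<open>Divisibility is unaffected by extending the field.\<close>
    also have "\<dots> \<longleftrightarrow> G' dvd map_poly to_ac T"
      unfolding G'_def using map_to_ac.hom_dvd to_ac.dvd_map_poly_hom_imp_dvd by blast
    also have "\<dots> \<longleftrightarrow> G' dvd A"
      using cong_dvd_iff[OF T_cong] by simp
    also have "\<dots> \<longleftrightarrow> A = 0"
    proof
      have "degree A < degree G'"
        unfolding A_def
      proof (rule degree_sum_less)
        fix k
        show "degree (smult (w k) (synthetic_div G' (b (fst k) (snd k)))) < degree G'"
          using deg by (intro le_less_trans[OF degree_smult_le]) (simp add: degree_synthetic_div deg_G')
      qed (use deg deg_G' in simp)
      then show "A = 0" if "G' dvd A"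
        using dvd_imp_degree_le[OF that] by (meson not_le)
    qed simp
    also have "\<dots> \<longleftrightarrow> (\<forall>j<degree G. (\<Sum>k\<in>K. w k * b (fst k) (snd k) ^ j) = 0)"
      unfolding A_def sum_synthetic_div_eq_0_iff deg_G' ..
    also have "\<dots> \<longleftrightarrow> ?R"
    proof (intro all_cong)
      fix j assume j: "j < degree G"
      have "(\<Sum>k\<in>K. w k * b (fst k) (snd k) ^ j) =
          (\<Sum>i<n. of_bit (c $ i) * (\<Sum>\<iota><degree (f i). b i \<iota> ^ j / poly G' (b i \<iota>)))"
        unfolding K_def w_def
        by (subst sum_Sigma_fst_snd[where h = "\<lambda>i \<iota>. of_bit (c $ i) / poly G' (b i \<iota>) * b i \<iota> ^ j"])
          (simp_all add: sum_distrib_left)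
      also have "\<dots> = (\<Sum>i<n. of_bit (c $ i) * to_ac (parity_mat (degree G) n f G \<gamma> $$ (j, i)))"
      proof (intro sum.cong refl)
        fix i assume "i \<in> {..<n}"
        then have i: "i < n"
          by simp
        show "of_bit (c $ i) * (\<Sum>\<iota><degree (f i). b i \<iota> ^ j / poly G' (b i \<iota>)) =
            of_bit (c $ i) * to_ac (parity_mat (degree G) n f G \<gamma> $$ (j, i))"
          unfolding to_ac_parity_mat[where f = f and \<gamma> = \<gamma>, OF card irr[OF i] root[OF i] j i] b_def G'_def ..
      qed
      also have "\<dots> = to_ac (\<Sum>i<n. of_bit (c $ i) * parity_mat (degree G) n f G \<gamma> $$ (j, i))"
        by (simp add: to_ac_sum)
      finally show "(\<Sum>k\<in>K. w k * b (fst k) (snd k) ^ j) = 0 \<longleftrightarrow>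
          (\<Sum>i<n. of_bit (c $ i) * parity_mat (degree G) n f G \<gamma> $$ (j, i)) = 0"
        by simp
    qed
    finally show ?thesis .
  qed
  then show ?thesis
    unfolding goppa_code_def by blast
qed

subsection \<open>Dimension\<close>

text \<open>Coordinates are linear over F_2 and all vanish only at 0, so each equation over F_q
  splits into \<open>length bs\<close> equations over F_2.\<close>

lemma binary_expansion_parity_check:
  fixes H :: "'a::{field, finite} mat"
  assumes card: "CARD('a) = 2 ^ m" and basis: "ordered_basis2 bs"
    and H: "H \<in> carrier_mat r n" and c: "c \<in> carrier_vec n"
  shows "binary_expansion bs H *\<^sub>v c = 0\<^sub>v (r * length bs) \<longleftrightarrow>
    (\<forall>j<r. (\<Sum>i<n. of_bit (c $ i) * H $$ (j, i)) = 0)"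
proof -
  interpret scale2: vector_space "scale2 :: bit \<Rightarrow> 'a \<Rightarrow> 'a"
    by (rule vector_space_scale2[OF card])
  have ind: "\<not> scale2.dependent (set bs)" and span: "v \<in> scale2.span (set bs)" for v
    using basis by (auto simp: ordered_basis2_def)
  define s where "s j = (\<Sum>i<n. scale2 (c $ i) (H $$ (j, i)))" for j
  define R where "R = scale2.representation (set bs)"
  have R_s: "R (s j) b = (\<Sum>i<n. R (H $$ (j, i)) b * c $ i)" for j b
    unfolding R_def s_def
    by (subst scale2.representation_sum[OF ind span])
      (simp only: scale2.representation_scale[OF ind span] mult.commute)
  have R_eq_0: "x = 0 \<longleftrightarrow> (\<forall>t<length bs. R x (bs ! t) = 0)" for x
  proof
    assume "\<forall>t<length bs. R x (bs ! t) = 0"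
    then have "(\<Sum>b\<in>set bs. scale2 (R x b) b) = 0"
      by (intro sum.neutral) (auto simp: in_set_conv_nth)
    then show "x = 0"
      unfolding R_def by (subst (asm) scale2.sum_representation_eq[OF ind span]) simp_all
  qed (simp add: R_def scale2.representation_zero)
  have entry: "(binary_expansion bs H *\<^sub>v c) $ k = R (s (k div length bs)) (bs ! (k mod length bs))"
    if "k < r * length bs" for k
    using that H c
    by (simp add: binary_expansion_def scalar_prod_def R_s atLeast0LessThan flip: R_def)
  have "binary_expansion bs H *\<^sub>v c = 0\<^sub>v (r * length bs) \<longleftrightarrow>
      (\<forall>k<r * length bs. R (s (k div length bs)) (bs ! (k mod length bs)) = 0)"
    using H by (auto simp: vec_eq_iff entry binary_expansion_def simp flip: entry)
  \<comment> \<open>The row index \<open>k\<close> is decoded as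
    \<open>j * length bs + t\<close>.\<close>
  also have "\<dots> \<longleftrightarrow> (\<forall>j<r. \<forall>t<length bs. R (s j) (bs ! t) = 0)"
  proof (intro iffI allI impI)
    fix j t
    assume *: "\<forall>k<r * length bs. R (s (k div length bs)) (bs ! (k mod length bs)) = 0"
      and jt: "j < r" "t < length bs"
    have "j * length bs + t < Suc j * length bs"
      using jt by simp
    also have "\<dots> \<le> r * length bs"
      using jt by (intro mult_le_mono1) simp
    finally have "R (s ((j * length bs + t) div length bs)) (bs ! ((j * length bs + t) mod length bs)) = 0"
      by (rule *[rule_format])
    moreover have "(j * length bs + t) div length bs = j"
      using jt by (subst div_mult_self3) auto
    ultimately show "R (s j) (bs ! t) = 0"
      using jt by simp
  next
    fix k
    assume *: "\<forall>j<r. \<forall>t<length bs. R (s j) (bs ! t) = 0" and k: "k < r * length bs"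
    then have "length bs > 0"
      by (cases "length bs") auto
    then show "R (s (k div length bs)) (bs ! (k mod length bs)) = 0"
      using * k by (simp add: less_mult_imp_div_less)
  qed
  also have "\<dots> \<longleftrightarrow> (\<forall>j<r. s j = 0)"
    by (simp only: R_eq_0)
  finally show ?thesis
    by (simp only: s_def scale2_def)
qed

text \<open>The image of the linear map given by \<open>A\<close> is the column space, whose
  dimension is the rank.\<close>

lemma rank_nullity_mat:
  fixes A :: "'a::field mat"
  assumes A: "A \<in> carrier_mat nr nc"
  shows "vec_space.rank nr A +
    vectorspace.dim class_ring ((module_vec TYPE('a) nc)\<lparr>carrier := {v \<in> carrier_vec nc. A *\<^sub>v v = 0\<^sub>v nr}\<rparr>) = nc"
proof -
  interpret V: vec_space "TYPE('a)" nc .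
  interpret W: vec_space "TYPE('a)" nr .
  interpret T: linear_map class_ring "module_vec TYPE('a) nc" "module_vec TYPE('a) nr" "(*\<^sub>v) A"
    by unfold_locales
      (use A in \<open>auto simp: module_hom_def module_vec_simps mult_add_distrib_mat_vec mult_mat_vec\<close>)
  have "T.im = W.span (set (cols A))"
    using W.col_space_eq[OF A] A by (auto simp: T.im_def W.col_space_def module_vec_simps)
  moreover have "T.ker = {v \<in> carrier_vec nc. A *\<^sub>v v = 0\<^sub>v nr}"
    by (simp add: T.ker_def module_vec_simps)
  ultimately show ?thesis
    using T.rank_nullity[OF V.fin_dim] by (simp add: W.rank_def V.dim_is_n)
qed

lemma (in vec_space) rank_le_nr:
  assumes A: "A \<in> carrier_mat n nc"
  shows "rank A \<le> n"
proof -
  have "set (cols A) \<subseteq> carrier_vec n"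
    using cols_dim[of A] A by simp
  then have "rank A \<le> dim"
    unfolding rank_def by (intro subspace_dim span_is_subspace fin_dim fin_dim_span_cols[OF A])
  then show ?thesis
    by (simp only: dim_is_n)
qed

subsection \<open>Minimum distance\<close>

lemma degree_pderiv_less:
  fixes p :: "'a::idom poly"
  assumes "degree p > 0"
  shows "degree (pderiv p) < degree p"
proof -
  have "degree (pderiv p) \<le> degree p - 1"
    by (rule degree_le) (simp add: coeff_pderiv coeff_eq_0)
  then show ?thesis
    using assms by simp
qed

text \<open>The conjugates of \<gamma> are distinct, so \<gamma> is a simple root and the derivative
  there is the value of the nonzero cofactor \<open>M\<close>.\<close>

lemma pderiv_irreducible_ne_0:
  fixes f :: "'a::{field, finite} poly"
  assumes card: "CARD('a) = 2 ^ m" and irr: "Factorial_Ring.irreducible f"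
    and root: "poly (map_poly to_ac f) \<gamma> = 0"
  shows "pderiv f \<noteq> 0"
proof
  define F where "F = map_poly to_ac f"
  define g where "g \<iota> = \<gamma> ^ CARD('a) ^ \<iota>" for \<iota>
  define M where "M = smult (to_ac (lead_coeff f)) (\<Prod>\<iota>\<in>{..<degree f} - {0}. [:- g \<iota>, 1:])"
  note deg = irreducible_field_poly_degree_pos[OF irr]
  have "F = [:- g 0, 1:] * M"
    unfolding F_def M_def irreducible_splits_frobenius_orbit[OF card irr root]
    using prod.remove[of "{..<degree f}" 0 "\<lambda>\<iota>. [:- g \<iota>, 1:]"] deg
    by (simp add: g_def)
  then have "pderiv F = [:- g 0, 1:] * pderiv M + M * pderiv [:- g 0, 1:]"
    by (simp only: pderiv_mult)
  then have "poly (pderiv F) (g 0) = poly M (g 0)"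
    by (simp add: pderiv_pCons)
  also have "\<dots> \<noteq> 0"
  proof -
    have "poly [:- g \<iota>, 1:] (g 0) \<noteq> 0" if "\<iota> \<in> {..<degree f} - {0}" for \<iota>
      using inj_onD[OF inj_on_frobenius_orbit[OF card irr root], of \<iota> 0] that deg
      by (auto simp: g_def)
    then have "(\<Prod>\<iota>\<in>{..<degree f} - {0}. poly [:- g \<iota>, 1:] (g 0)) \<noteq> 0"
      by (subst prod_zero_iff) blast+
    moreover have "to_ac (lead_coeff f) \<noteq> 0"
      using irr by auto
    ultimately show ?thesis
      by (simp only: M_def poly_smult poly_prod mult_eq_0_iff not_False_eq_True simp_thms)
  qed
  finally show False if "pderiv f = 0"
    using that by (simp add: F_def flip: to_ac.map_poly_pderiv)
qed

lemma goppa_code_degree_bound: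
  fixes f :: "nat \<Rightarrow> 'a::{field, finite} poly" and c :: "bit vec"
  assumes card: "CARD('a) = 2 ^ m" and deg: "degree G > 0"
    and irr: "\<And>i. i < n \<Longrightarrow> Factorial_Ring.irreducible (f i)"
    and cop: "\<And>i j. i < n \<Longrightarrow> j < n \<Longrightarrow> i \<noteq> j \<Longrightarrow> coprime (f i) (f j)"
    and cop_G: "\<And>i. i < n \<Longrightarrow> coprime (f i) G"
    and root: "\<And>i. i < n \<Longrightarrow> poly (map_poly to_ac (f i)) (\<gamma> i) = 0"
    and c: "c \<in> goppa_code n f G" "c \<noteq> 0\<^sub>v n"
  shows "degree G < (\<Sum>i | i < n \<and> c $ i \<noteq> 0. degree (f i))"
proof -
  define S where "S = {i. i < n \<and> c $ i \<noteq> 0}"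
  define P where "P = (\<Prod>i\<in>S. f i)"
  define M where "M i = (\<Prod>j\<in>S - {i}. f j)" for i
  have S: "finite S" "\<And>i. i \<in> S \<Longrightarrow> i < n"
    by (auto simp: S_def)
  have cv: "c \<in> carrier_vec n"
    using c(1) by (simp add: goppa_code_def)
  have "S \<noteq> {}"
    using c(2) cv by (auto simp: S_def vec_eq_iff)
  have P_M: "P = f i * M i" if "i \<in> S" for i
    unfolding P_def M_def by (rule prod.remove[OF S(1) that])
  have P': "pderiv P = (\<Sum>i\<in>S. M i * pderiv (f i))"
    unfolding P_def M_def by (rule pderiv_prod)
  \<comment> \<open>Nonzero bits map to 1, so only the support contributes, with all weights equal
    to 1.\<close>
  have "(\<Sum>i<n. smult (of_bit (c $ i)) (pderiv (f i) * poly_inverse_mod G (f i)))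
      = (\<Sum>i\<in>S. pderiv (f i) * poly_inverse_mod G (f i))"
    by (intro sum.mono_neutral_cong_right) (auto simp: S_def)
  then have "G dvd (\<Sum>i\<in>S. pderiv (f i) * poly_inverse_mod G (f i))"
    using c(1) by (simp add: goppa_code_def cong_0_iff)
  \<comment> \<open>Multiplying by \<open>P\<close> cancels the inverses modulo \<open>G\<close> and
    leaves the product rule for \<open>pderiv P\<close>.\<close>
  then have "G dvd P * (\<Sum>i\<in>S. pderiv (f i) * poly_inverse_mod G (f i))"
    by (rule dvd_mult)
  moreover have "[P * (\<Sum>i\<in>S. pderiv (f i) * poly_inverse_mod G (f i)) = pderiv P] (mod G)"
    unfolding P' sum_distrib_left
  proof (rule cong_sum)
    fix i assume i: "i \<in> S"
    have "[M i * pderiv (f i) * (f i * poly_inverse_mod G (f i)) = M i * pderiv (f i) * 1] (mod G)"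
      by (intro cong_mult cong_refl poly_inverse_mod_cong cop_G S(2) i deg)
    then show "[P * (pderiv (f i) * poly_inverse_mod G (f i)) = M i * pderiv (f i)] (mod G)"
      by (simp add: P_M[OF i] mult_ac)
  qed
  ultimately have G_dvd: "G dvd pderiv P"
    using cong_dvd_iff by blast
  have "pderiv P \<noteq> 0"
  proof
    assume *: "pderiv P = 0"
    obtain i where i: "i \<in> S"
      using \<open>S \<noteq> {}\<close> by blast
    have prime: "prime_elem (f i)"
      by (rule field_poly_irreducible_imp_prime[OF irr[OF S(2)[OF i]]])
    \<comment> \<open>Every summand of \<open>pderiv P\<close> except the \<open>i\<close>-th
      contains the factor \<open>f i\<close>, so a vanishing sum makes \<open>f i\<close> divide
      that one too.\<close>
    have "f i dvd M j * pderiv (f j)" if "j \<in> S - {i}" for j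
      using that i S(1) by (auto simp: M_def intro!: dvd_mult2 dvd_prodI)
    then have "f i dvd (\<Sum>j\<in>S - {i}. M j * pderiv (f j))"
      by (rule dvd_sum)
    moreover have "(\<Sum>j\<in>S - {i}. M j * pderiv (f j)) = - (M i * pderiv (f i))"
      using * unfolding P' sum.remove[OF S(1) i] by (simp add: add_eq_0_iff2)
    ultimately have "f i dvd M i * pderiv (f i)"
      by simp
    then have "f i dvd M i \<or> f i dvd pderiv (f i)"
      by (rule prime_elem_dvd_multD[OF prime])
    moreover have "\<not> f i dvd M i"
    proof
      assume "f i dvd M i"
      then obtain j where j: "j \<in> S - {i}" "f i dvd f j"
        unfolding M_def prod_unfold_prod_mset
        by (rule prime_elem_dvd_prod_msetE[OF prime]) (use S(1) in auto)
      then have "is_unit (f i)"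
        using coprime_common_divisor[OF cop[of i j]] i S(2) by auto
      then show False
        using prime_elem_not_unit[OF prime] by blast
    qed
    ultimately have "f i dvd pderiv (f i)"
      by blast
    \<comment> \<open>Separability makes \<open>pderiv (f i)\<close> nonzero, so the divisibility
      contradicts its smaller degree.\<close>
    then have "degree (f i) \<le> degree (pderiv (f i))"
      using pderiv_irreducible_ne_0[OF card irr root] S(2)[OF i] by (intro dvd_imp_degree_le) auto
    then show False
      using degree_pderiv_less[OF irreducible_field_poly_degree_pos[OF irr[OF S(2)[OF i]]]] by simp
  qed
  then have "degree G \<le> degree (pderiv P)"
    using G_dvd dvd_imp_degree_le by blast
  also have "\<dots> < degree P"
  proof (rule degree_pderiv_less)
    show "degree P > 0"
      using \<open>pderiv P \<noteq> 0\<close> by (metis degree_eq_zeroE gr0I pderiv_pCons pderiv_0 add_0 pCons_0_0)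
  qed
  also have "degree P = (\<Sum>i\<in>S. degree (f i))"
    unfolding P_def using irr S(2) by (intro degree_prod_eq_sum_degree) fastforce
  finally show ?thesis
    by (simp add: S_def)
qed

section \<open>Dimension and minimum distance of the code\<close>

theorem theorem2:
  fixes m n r :: nat
    and f :: "nat \<Rightarrow> 'a::{field, finite} poly"
    and G :: "'a poly"
    and \<gamma> :: "nat \<Rightarrow> 'a alg_closure"
    and bs :: "'a list"
  assumes "m > 0" and "n > 0" and "r > 0" and "r * m \<le> n"
    and "CARD('a) = 2 ^ m"
    and "degree G = r"
    and "\<And>i. i < n \<Longrightarrow> Factorial_Ring.irreducible (f i)"
    and "\<And>i j. i < n \<Longrightarrow> j < n \<Longrightarrow> i \<noteq> j \<Longrightarrow> coprime (f i) (f j)"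
    and "\<And>i. i < n \<Longrightarrow> coprime (f i) G"
    and "\<And>i. i < n \<Longrightarrow> poly (map_poly to_ac (f i)) (\<gamma> i) = 0"
    and "ordered_basis2 bs" and "length bs = m"
  defines "\<Gamma> \<equiv> goppa_code n f G"
    and "Hbin \<equiv> binary_expansion bs (parity_mat r n f G \<gamma>)"
    and "l \<equiv> Max (degree ` f ` {..<n})"
  shows "int (code_dim n \<Gamma>) = int n - int (vec_space.rank (r * m) Hbin)
    \<and> int (code_dim n \<Gamma>) \<ge> int n - int (r * m)
    \<and> (\<Gamma> \<noteq> {0\<^sub>v n} \<longrightarrow> real (min_dist n \<Gamma>) \<ge> real (r + 1) / real l)"
proof (intro conjI impI)
  have deg: "degree G > 0"
    using assms(3,6) by simp
  have H: "parity_mat r n f G \<gamma> \<in> carrier_mat r n"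
    by (simp add: parity_mat_def)
  have Hbin: "Hbin \<in> carrier_mat (r * m) n"
    using H assms(12) by (simp add: Hbin_def binary_expansion_def)
  \<comment> \<open>The code is the kernel of \<open>Hbin\<close>, so rank-nullity gives its
    dimension.\<close>
  have "\<Gamma> = {c \<in> carrier_vec n. Hbin *\<^sub>v c = 0\<^sub>v (r * m)}"
  proof -
    have "\<Gamma> = {c \<in> carrier_vec n. \<forall>j<r. (\<Sum>i<n. of_bit (c $ i) * parity_mat r n f G \<gamma> $$ (j, i)) = 0}"
      using goppa_code_parity_checks[where f = f and \<gamma> = \<gamma>, OF assms(5) deg assms(7,9,10)]
      unfolding \<Gamma>_def assms(6) by blast
    also have "\<dots> = {c \<in> carrier_vec n. Hbin *\<^sub>v c = 0\<^sub>v (r * m)}"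
      unfolding Hbin_def
      by (intro Collect_cong conj_cong refl)
        (rule binary_expansion_parity_check[OF assms(5,11) H, unfolded assms(12), symmetric])
    finally show ?thesis .
  qed
  then have dim: "vec_space.rank (r * m) Hbin + code_dim n \<Gamma> = n"
    unfolding code_dim_def using rank_nullity_mat[OF Hbin] by simp
  then show "int (code_dim n \<Gamma>) = int n - int (vec_space.rank (r * m) Hbin)"
    by linarith
  show "int (code_dim n \<Gamma>) \<ge> int n - int (r * m)"
    using dim vec_space.rank_le_nr[OF Hbin] by linarith
  assume "\<Gamma> \<noteq> {0\<^sub>v n}"
  \<comment> \<open>As the zero word is a codeword, a code other than \<open>{0\<^sub>v n}\<close>
    has a nonzero one, so \<open>Min\<close> ranges over a nonempty set.\<close>
  have "0\<^sub>v n \<in> \<Gamma>"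
    by (simp add: \<Gamma>_def goppa_code_def)
  then have ne: "hamming_weight ` (\<Gamma> - {0\<^sub>v n}) \<noteq> {}"
    using \<open>\<Gamma> \<noteq> {0\<^sub>v n}\<close> by blast
  have weight: "hamming_weight c = card {i. i < n \<and> c $ i \<noteq> 0}" if "c \<in> \<Gamma>" for c
    using that by (auto simp: hamming_weight_def \<Gamma>_def goppa_code_def)
  \<comment> \<open>Boundedness makes the set of weights finite, so its minimum is attained by a
    codeword.\<close>
  have "hamming_weight ` (\<Gamma> - {0\<^sub>v n}) \<subseteq> {..n}"
  proof
    fix w assume "w \<in> hamming_weight ` (\<Gamma> - {0\<^sub>v n})"
    then obtain c where "c \<in> \<Gamma>" "w = hamming_weight c"
      by blast
    then have "w = card {i. i < n \<and> c $ i \<noteq> 0}"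
      using weight by simp
    also have "\<dots> \<le> card {..<n}"
      by (intro card_mono) auto
    finally show "w \<in> {..n}"
      by simp
  qed
  then have "min_dist n \<Gamma> \<in> hamming_weight ` (\<Gamma> - {0\<^sub>v n})"
    unfolding min_dist_def using ne by (intro Min_in) (auto intro: finite_subset)
  then obtain c where c: "c \<in> \<Gamma>" "c \<noteq> 0\<^sub>v n" "min_dist n \<Gamma> = hamming_weight c"
    by auto
  have "degree G < (\<Sum>i | i < n \<and> c $ i \<noteq> 0. degree (f i))"
    using goppa_code_degree_bound[where f = f and \<gamma> = \<gamma>, OF assms(5) deg assms(7-10)] c by (auto simp: \<Gamma>_def)
  also have "\<dots> \<le> (\<Sum>i | i < n \<and> c $ i \<noteq> 0. l)"
    unfolding l_def by (intro sum_mono Max_ge) auto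
  also have "\<dots> = min_dist n \<Gamma> * l"
    by (simp add: c(3) weight[OF c(1)])
  \<comment> \<open>The strict inequality between natural numbers supplies the summand 1.\<close>
  finally have "r + 1 \<le> min_dist n \<Gamma> * l"
    using assms(6) by simp
  then have "real (r + 1) \<le> real (min_dist n \<Gamma>) * real l"
    by (simp only: of_nat_le_iff flip: of_nat_mult)
  moreover have "l > 0"
    using \<open>r + 1 \<le> min_dist n \<Gamma> * l\<close> by (cases "l = 0") simp_all
  ultimately show "real (min_dist n \<Gamma>) \<ge> real (r + 1) / real l"
    by (simp add: pos_divide_le_eq)
qed

end
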